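(* Let $0<\delta<1$, and let $y_0,y_1,y_2,\ldots\in\mathbb{X}$ be the solution components generated by the recursive scheme described in the context, with convergence-control parameter $c_0\neq 0$. Suppose that there exists $k_0\in\mathbb{N}$ such that for all $k\ge k_0$, $$\|y_{k+1}\|\le \delta\,\|y_k\|.$$ Then the series $\sum_{k=0}^{\infty}y_k(x)$ is convergent (in the Banach space $\mathbb{X}$).
   Context: $\mathbb{X}=C[0,1]$ is the Banach space of continuous real functions on $[0,1]$ with norm $\|y\|=\max_{x\in[0,1]}|y(x)|$. Standing assumptions on the data $p,q,f$: - $p\in C[0,1]\cap C^1(0,1]$, $p(0)=0$, and $p(x)>0$, $q(x)>0$ on $(0,1]$ ($q$ may be discontinuous at $0$). - With $\Omega=(0,1]\times\mathbb{R}$, $f$ and $f_y=\partial f/\partial y$ are continuous on $\Omega$ and $f_y\ge 0$ on $\Omega$. In addition, $f$ has the $y$-derivatives needed to define the operators $\mathcal{D}_k$ below. The constants $\delta_1,\alpha_i,\beta_i,\gamma_i$ ($i=1,2$) are real. The function $g$ and kernel $G$ are given by one of the following two cases, which correspond to the problem $-(p(x)y'(x))'=q(x)f(x,y(x))$, $0<x<1$, with the indicated boundary conditions. Case (I): $y(0)=\delta_1$, $\alpha_1y(1)+\beta_1y'(1)=\gamma_1$. Assume $\frac1p\in L^1(0,1]$ and $\int_0^1\frac1{p(x)}\int_x^1q(s)\,ds\,dx<\infty$. Put $h(x)=\int_0^x\frac{dt}{p(t)}$ and $\mu=\alpha_1h(1)+\beta_1h'(1)$, where $h'(1)=1/p(1)$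 and $\mu\ne0$. Then $$g(x)=\delta_1+\frac{\gamma_1-\delta_1\alpha_1}{\mu}h(x),\qquad G(x,s)=\begin{cases}h(x)\left[1-\frac{\alpha_1h(s)}{\mu}\right],&0\le x\le s,\\ h(s)\left[1-\frac{\alpha_1h(x)}{\mu}\right],&s\le x\le1.\end{cases}$$ Case (II): $\lim_{x\to0^+}p(x)y'(x)=0$, $\alpha_2y(1)+\beta_2y'(1)=\gamma_2$, with $\alpha_2\neq0$. Assume $q\in L^1(0,1]$ and $\int_0^1\frac1{p(x)}\int_0^xq(s)\,ds\,dx<\infty$. Then $$g(x)=\frac{\gamma_2}{\alpha_2},\qquad G(x,s)=\begin{cases}\int_s^1\frac{dt}{p(t)}+\frac{\beta_2}{\alpha_2p(1)},&0<x\le s,\\ \int_s^1\frac{dt}{p(t)}-\int_s^x\frac{dt}{p(t)}+\frac{\beta_2}{\alpha_2p(1)},&s\le x\le1.\end{cases}$$ Recursive scheme. For $k\ge1$ define $$\mathcal{D}_{k-1}[f(\phi)](s)=\frac1{(k-1)!}\frac{\partial^{k-1}}{\partial r^{k-1}}f\Big(s,\sum_{j=0}^{k-1}y_j(s)r^j\Big)\Big|_{r=0}.$$ Fix a real $c_0\neq0$ and set $y_0=g$, $$y_1(x)=c_0\Big\{y_0(x)-g(x)-\int_0^1G(x,s)q(s)\mathcal{D}_0[f(\phi)](s)\,ds\Big\},$$ $$y_k(x)=(1+c_0)y_{k-1}(x)-c_0\int_0^1G(x,s)q(s)\mathcal{D}_{k-1}[f(\phi)](s)\,ds\qquad(k\ge2).$$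 The components $y_k$ are assumed to be well-defined elements of $\mathbb{X}$. *)

theory Defs
  imports "HOL-Analysis.Analysis"
begin

text \<open>
  The Banach space \<open>C[0,1]\<close>. Its elements are represented by functions on the reals of which only
  the values on \<open>[0,1]\<close> matter. For continuous functions the supremum below is the maximum.
\<close>

definition C01 :: "(real \<Rightarrow> real) set"
  where "C01 = {u. continuous_on {0..1} u}"

definition C01_norm :: "(real \<Rightarrow> real) \<Rightarrow> real"
  where "C01_norm u = (SUP x\<in>{0..1}. \<bar>u x\<bar>)"

definition C01_series_convergent :: "(nat \<Rightarrow> real \<Rightarrow> real) \<Rightarrow> bool"
  where "C01_series_convergent y \<longleftrightarrow>
    (\<exists>S\<in>C01. (\<lambda>n. C01_norm (\<lambda>x. (\<Sum>k<n. y k x) - S x)) \<longlonglongrightarrow> 0)"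

text \<open>
  Standing assumptions on the data. The derivative of \<open>p\<close> at \<open>1\<close> is one-sided, and
  \<open>deriv (f x)\<close> is the partial derivative \<open>f\<^sub>y(x, _)\<close>.
\<close>

definition coefficient_assms :: "(real \<Rightarrow> real) \<Rightarrow> (real \<Rightarrow> real) \<Rightarrow> bool"
  where "coefficient_assms p q \<longleftrightarrow>
    p \<in> C01 \<and>
    (\<exists>p'. continuous_on {0<..1} p' \<and>
       (\<forall>x\<in>{0<..1}. (p has_real_derivative p' x) (at x within {0<..1}))) \<and>
    p 0 = 0 \<and> (\<forall>x\<in>{0<..1}. p x > 0 \<and> q x > 0)"

definition nonlinearity_assms :: "(real \<Rightarrow> real \<Rightarrow> real) \<Rightarrow> bool"
  where "nonlinearity_assms f \<longleftrightarrow>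
    continuous_on ({0<..1} \<times> UNIV) (\<lambda>(x, y). f x y) \<and>
    (\<forall>x\<in>{0<..1}. \<forall>y. f x differentiable at y) \<and>
    continuous_on ({0<..1} \<times> UNIV) (\<lambda>(x, y). deriv (f x) y) \<and>
    (\<forall>x\<in>{0<..1}. \<forall>y. deriv (f x) y \<ge> 0)"

text \<open>
  The operators \<open>D\<^sub>n\<close> differentiate \<open>f(s, _)\<close> at \<open>y\<^sub>0(s) = g(s)\<close> only, so they need the
  \<open>y\<close>-derivatives of every order near that point; the neighbourhood may depend on the order.
\<close>

definition y_derivatives_exist :: "(real \<Rightarrow> real \<Rightarrow> real) \<Rightarrow> (real \<Rightarrow> real) \<Rightarrow> bool"
  where "y_derivatives_exist f g \<longleftrightarrow>
    (\<forall>s\<in>{0<..1}. \<forall>n. \<forall>\<^sub>F z in nhds (g s). (deriv ^^ n) (f s) differentiable at z)"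

definition D_op :: "(real \<Rightarrow> real \<Rightarrow> real) \<Rightarrow> (nat \<Rightarrow> real \<Rightarrow> real) \<Rightarrow> nat \<Rightarrow> real \<Rightarrow> real"
  where "D_op f y n s = (deriv ^^ n) (\<lambda>r. f s (\<Sum>j\<le>n. y j s * r ^ j)) 0 / fact n"

text \<open>
  All integrals are Lebesgue integrals; the finiteness of the iterated integral of the
  positive functions \<open>1/p\<close> and \<open>q\<close> is expressed by integrability of the inner and outer integrands.
\<close>

definition case1_assms ::
    "(real \<Rightarrow> real) \<Rightarrow> (real \<Rightarrow> real) \<Rightarrow> bool"
  where "case1_assms p q \<longleftrightarrow>
    set_integrable lebesgue {0<..1} (\<lambda>t. 1 / p t) \<and>
    (\<forall>x\<in>{0<..1}. set_integrable lebesgue {x..1} q) \<and>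
    set_integrable lebesgue {0<..1} (\<lambda>x. 1 / p x * (LINT s:{x..1}|lebesgue. q s))"

definition h1 :: "(real \<Rightarrow> real) \<Rightarrow> real \<Rightarrow> real"
  where "h1 p x = (LINT t:{0<..x}|lebesgue. 1 / p t)"

text \<open>Here \<open>1 / p 1\<close> is \<open>h'(1)\<close>.\<close>

definition mu1 :: "(real \<Rightarrow> real) \<Rightarrow> real \<Rightarrow> real \<Rightarrow> real"
  where "mu1 p \<alpha> \<beta> = \<alpha> * h1 p 1 + \<beta> * (1 / p 1)"

definition g1 :: "(real \<Rightarrow> real) \<Rightarrow> real \<Rightarrow> real \<Rightarrow> real \<Rightarrow> real \<Rightarrow> real \<Rightarrow> real"
  where "g1 p \<delta> \<alpha> \<beta> \<gamma> x = \<delta> + (\<gamma> - \<delta> * \<alpha>) / mu1 p \<alpha> \<beta> * h1 p x"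

definition G1 :: "(real \<Rightarrow> real) \<Rightarrow> real \<Rightarrow> real \<Rightarrow> real \<Rightarrow> real \<Rightarrow> real"
  where "G1 p \<alpha> \<beta> x s =
    (if x \<le> s then h1 p x * (1 - \<alpha> * h1 p s / mu1 p \<alpha> \<beta>)
     else h1 p s * (1 - \<alpha> * h1 p x / mu1 p \<alpha> \<beta>))"

definition case2_assms :: "(real \<Rightarrow> real) \<Rightarrow> (real \<Rightarrow> real) \<Rightarrow> bool"
  where "case2_assms p q \<longleftrightarrow>
    set_integrable lebesgue {0<..1} q \<and>
    set_integrable lebesgue {0<..1} (\<lambda>x. 1 / p x * (LINT s:{0<..x}|lebesgue. q s))"

definition g2 :: "real \<Rightarrow> real \<Rightarrow> real \<Rightarrow> real"
  where "g2 \<alpha> \<gamma> x = \<gamma> / \<alpha>"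

definition G2 :: "(real \<Rightarrow> real) \<Rightarrow> real \<Rightarrow> real \<Rightarrow> real \<Rightarrow> real \<Rightarrow> real"
  where "G2 p \<alpha> \<beta> x s =
    (if x \<le> s then (LINT t:{s..1}|lebesgue. 1 / p t) + \<beta> / (\<alpha> * p 1)
     else (LINT t:{s..1}|lebesgue. 1 / p t) - (LINT t:{s..x}|lebesgue. 1 / p t)
            + \<beta> / (\<alpha> * p 1))"

text \<open>
  \<open>E\<close> is the set of points \<open>x\<close> at which the kernel \<open>G(x, s)\<close> is given: in case (II) it excludes \<open>0\<close>.
\<close>

definition case1_problem where
  "case1_problem p q \<delta>\<^sub>1 \<alpha>\<^sub>1 \<beta>\<^sub>1 \<gamma>\<^sub>1 g G E \<longleftrightarrow>
     case1_assms p q \<and> mu1 p \<alpha>\<^sub>1 \<beta>\<^sub>1 \<noteq> 0 \<and>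
     g = g1 p \<delta>\<^sub>1 \<alpha>\<^sub>1 \<beta>\<^sub>1 \<gamma>\<^sub>1 \<and> G = G1 p \<alpha>\<^sub>1 \<beta>\<^sub>1 \<and> E = {0..1::real}"

definition case2_problem where
  "case2_problem p q \<alpha>\<^sub>2 \<beta>\<^sub>2 \<gamma>\<^sub>2 g G E \<longleftrightarrow>
     case2_assms p q \<and> \<alpha>\<^sub>2 \<noteq> 0 \<and>
     g = g2 \<alpha>\<^sub>2 \<gamma>\<^sub>2 \<and> G = G2 p \<alpha>\<^sub>2 \<beta>\<^sub>2 \<and> E = {0<..1::real}"

text \<open>
  \<open>y\<close> is the sequence of solution components: well-defined elements of \<open>C[0,1]\<close> (in particular the
  integrals exist) satisfying the recursion. In case (II) the value of \<open>y k\<close> at \<open>0\<close> for \<open>k \<ge> 1\<close> is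
  determined by continuity.
\<close>

definition solution_components ::
    "(real \<Rightarrow> real) \<Rightarrow> (real \<Rightarrow> real \<Rightarrow> real) \<Rightarrow> (real \<Rightarrow> real) \<Rightarrow> (real \<Rightarrow> real \<Rightarrow> real) \<Rightarrow> real set \<Rightarrow>
     real \<Rightarrow> (nat \<Rightarrow> real \<Rightarrow> real) \<Rightarrow> bool"
  where "solution_components q f g G E c\<^sub>0 y \<longleftrightarrow>
    (\<forall>k. y k \<in> C01) \<and>
    (\<forall>k\<ge>1. \<forall>x\<in>E. set_integrable lebesgue {0<..1} (\<lambda>s. G x s * q s * D_op f y (k - 1) s)) \<and>
    (\<forall>x\<in>{0..1}. y 0 x = g x) \<and>
    (\<forall>x\<in>E. y 1 x =
       c\<^sub>0 * (y 0 x - g x - (LINT s:{0<..1}|lebesgue. G x s * q s * D_op f y 0 s))) \<and>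
    (\<forall>k\<ge>2. \<forall>x\<in>E. y k x =
       (1 + c\<^sub>0) * y (k - 1) x
         - c\<^sub>0 * (LINT s:{0<..1}|lebesgue. G x s * q s * D_op f y (k - 1) s))"

end

theory Submission
  imports Defs
begin

text \<open>
  Contraction of the norms from some index on lets the series \<open>\<Sum>k. \<parallel>y k\<parallel>\<close> be compared with a
  geometric series of ratio \<open>\<delta> < 1\<close>, so the series of components converges absolutely in \<open>C[0,1]\<close>.
  Absolute convergence gives convergence because \<open>C[0,1]\<close> is complete
  (\<open>C01_series_convergent_if_norm_summable\<close>): the norms are majorants in Weierstrass' test, which
  makes the partial sums converge uniformly on \<open>[0,1]\<close>, and a uniform limit of continuous functions
  is continuous.
\<close>

lemma abs_le_C01_norm:
  assumes "u \<in> C01" "x \<in> {0..1}"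
  shows "\<bar>u x\<bar> \<le> C01_norm u"
proof -
  have "compact ((\<lambda>x. \<bar>u x\<bar>) ` {0..1})"
    using assms(1) unfolding C01_def
    by (intro compact_continuous_image continuous_intros) auto
  then have "bdd_above ((\<lambda>x. \<bar>u x\<bar>) ` {0..1})"
    by (intro bounded_imp_bdd_above compact_imp_bounded)
  then show ?thesis
    unfolding C01_norm_def by (rule cSUP_upper[OF assms(2)])
qed

lemma C01_norm_nonneg:
  assumes "u \<in> C01"
  shows "0 \<le> C01_norm u"
  using abs_le_C01_norm[OF assms, of 0] by simp

lemma C01_norm_le:
  assumes "\<And>x. x \<in> {0..1} \<Longrightarrow> \<bar>u x\<bar> \<le> B"
  shows "C01_norm u \<le> B"
  unfolding C01_norm_def by (rule cSUP_least) (use assms in auto)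

text \<open>Weierstrass' test supplies both the pointwise limit and uniformity of the convergence; uniformity
  makes the limit continuous and is convergence in the maximum norm. This is the completeness of
  \<open>C[0,1]\<close>, expressed for absolutely convergent series.\<close>

lemma C01_series_convergent_if_norm_summable:
  assumes y: "\<And>k. y k \<in> C01" and sm: "summable (\<lambda>k. C01_norm (y k))"
  shows "C01_series_convergent y"
proof -
  define S where "S = (\<lambda>x. \<Sum>k. y k x)"
  have lim: "uniform_limit {0..1} (\<lambda>n x. \<Sum>k<n. y k x) S sequentially"
    unfolding S_def
    by (rule Weierstrass_m_test[OF _ sm]) (use abs_le_C01_norm[OF y] in auto)
  have partial: "continuous_on {0..1} (\<lambda>x. \<Sum>k<n. y k x)" for n
    using y by (intro continuous_on_sum) (auto simp: C01_def)
  have S: "continuous_on {0..1} S"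
    by (rule uniform_limit_theorem[OF _ lim]) (use partial in auto)
  have "(\<lambda>n. C01_norm (\<lambda>x. (\<Sum>k<n. y k x) - S x)) \<longlonglongrightarrow> 0"
  proof (rule tendstoI)
    fix e :: real
    assume "e > 0"
    then have "\<forall>\<^sub>F n in sequentially. \<forall>x\<in>{0..1}. dist (\<Sum>k<n. y k x) (S x) < e / 2"
      using uniform_limitD[OF lim, of "e / 2"] by simp
    then show "\<forall>\<^sub>F n in sequentially. dist (C01_norm (\<lambda>x. (\<Sum>k<n. y k x) - S x)) 0 < e"
    proof eventually_elim
      case (elim n)
      have "C01_norm (\<lambda>x. (\<Sum>k<n. y k x) - S x) \<le> e / 2"
        using elim by (intro C01_norm_le) (force simp: dist_real_def)
      moreover have "0 \<le> C01_norm (\<lambda>x. (\<Sum>k<n. y k x) - S x)"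
        using partial S by (intro C01_norm_nonneg) (auto simp: C01_def intro: continuous_on_diff)
      ultimately show ?case
        using \<open>e > 0\<close> by simp
    qed
  qed
  then show ?thesis
    using S unfolding C01_series_convergent_def C01_def by blast
qed

theorem theorem3p1:
  fixes p q :: "real \<Rightarrow> real" and f :: "real \<Rightarrow> real \<Rightarrow> real"
    and \<delta>\<^sub>1 \<alpha>\<^sub>1 \<beta>\<^sub>1 \<gamma>\<^sub>1 \<alpha>\<^sub>2 \<beta>\<^sub>2 \<gamma>\<^sub>2 :: real
    and g :: "real \<Rightarrow> real" and G :: "real \<Rightarrow> real \<Rightarrow> real" and E :: "real set"
    and c\<^sub>0 \<delta> :: real and y :: "nat \<Rightarrow> real \<Rightarrow> real"
  assumes "coefficient_assms p q"
    and "nonlinearity_assms f"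
    and "case1_problem p q \<delta>\<^sub>1 \<alpha>\<^sub>1 \<beta>\<^sub>1 \<gamma>\<^sub>1 g G E \<or> case2_problem p q \<alpha>\<^sub>2 \<beta>\<^sub>2 \<gamma>\<^sub>2 g G E"
    and "y_derivatives_exist f g"
    and "c\<^sub>0 \<noteq> 0"
    and "solution_components q f g G E c\<^sub>0 y"
    and "0 < \<delta>" and "\<delta> < 1"
    and "\<exists>k\<^sub>0::nat. \<forall>k\<ge>k\<^sub>0. C01_norm (y (k + 1)) \<le> \<delta> * C01_norm (y k)"
  shows "C01_series_convergent y"
proof -
  have y: "y k \<in> C01" for k
    using assms(6) unfolding solution_components_def by blast
  obtain k\<^sub>0 where "\<And>k. k \<ge> k\<^sub>0 \<Longrightarrow> C01_norm (y (k + 1)) \<le> \<delta> * C01_norm (y k)"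
    using assms(9) by blast
  then have "summable (\<lambda>k. C01_norm (y k))"
    by (intro summable_ratio_test[OF \<open>\<delta> < 1\<close>, of k\<^sub>0]) (use C01_norm_nonneg[OF y] in simp)
  then show ?thesis
    by (rule C01_series_convergent_if_norm_summable[OF y])
qed

end
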